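(* Let $\mathcal{A}$ be an arbitrary alphabet, $f:\mathcal{A}^*\to\mathbb{C}$ a function and $n\ge 0$ an integer. Then $f$ is a polynomial map of functional degree $\le n$ on $\mathcal{A}^*$ if and only if, for every finite sub-alphabet $B\subseteq\mathcal{A}$, the restriction $f|_{B^*}:B^*\to\mathbb{C}$ is a finite linear combination (over $\mathbb{C}$) of subword counters $f_w$ with $w\in B^*$ and $|w|\le n$. In other words, $f\in\mathcal{P}_n(\mathcal{A}^*,\mathbb{C})$ if and only if $f|_{B^*}\in\mathcal{P}_n(B^*,\mathbb{C})$ for each finite alphabet $B\subseteq\mathcal{A}$.
   Context: For an alphabet $\mathcal{A}$, $\mathcal{A}^*$ is the free monoid of words over $\mathcal{A}$ under concatenation, with identity the empty word $\epsilon$. Let $(S,\cdot,e)$ be a monoid and $(G,+,0)$ a commutative group. For $s\in S$ define operators on functions $f:S\to G$ by $L_s(f)(t)=f(st)-f(t)$ and $R_s(f)(t)=f(ts)-f(t)$. Polynomial maps and functional degree are defined inductively: constant functions are polynomial maps; the constant $0$ has functional degree $-\infty$, nonzero constants have functional degree $0$ (so the maps of functional degree $\le 0$ are exactly the constants). For $n\ge 1$, $f:S\to G$ is a polynomial map of functional degree $\le n$ if and only if for each $s\in S$ both $R_s(f)$ and $L_s(f)$ are polynomial maps of functional degree $\le n-1$. $\mathcal{P}_n(S,G)$ is the set of polynomial maps $f:S\to G$ with functional degree $\le n$. Here $G=(\mathbb{C},+)$. For words $x=x_1\cdots x_m$ and $w=w_1\cdots w_d$, $f_w(x)=[x]_w$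 is the number of times $w$ occurs as a scattered subword of $x$, i.e. the number of index tuples $1\le i_1<\dots<i_d\le m$ with $x_{i_k}=w_k$ for all $k$; $[x]_\epsilon=1$ for all $x$. $|w|$ denotes the length of $w$. *)

theory Defs
  imports Complex_Main "HOL-Algebra.Group"
begin

definition left_diff :: "('s, 'm) monoid_scheme \<Rightarrow> 's \<Rightarrow> ('s \<Rightarrow> 'g::ab_group_add) \<Rightarrow> 's \<Rightarrow> 'g" where
  "left_diff S s f = (\<lambda>t. f (s \<otimes>\<^bsub>S\<^esub> t) - f t)"

definition right_diff :: "('s, 'm) monoid_scheme \<Rightarrow> 's \<Rightarrow> ('s \<Rightarrow> 'g::ab_group_add) \<Rightarrow> 's \<Rightarrow> 'g" where
  "right_diff S s f = (\<lambda>t. f (t \<otimes>\<^bsub>S\<^esub> s) - f t)"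

text \<open>A map from the monoid \<open>S\<close> to \<open>G\<close> is a total function of which only the values
  on \<open>carrier S\<close> matter; see \<open>fdeg_le_cong\<close>.\<close>

primrec fdeg_le :: "('s, 'm) monoid_scheme \<Rightarrow> nat \<Rightarrow> ('s \<Rightarrow> 'g::ab_group_add) \<Rightarrow> bool" where
  "fdeg_le S 0 f \<longleftrightarrow> (\<exists>c. \<forall>x\<in>carrier S. f x = c)"
| "fdeg_le S (Suc n) f \<longleftrightarrow>
     (\<forall>s\<in>carrier S. fdeg_le S n (right_diff S s f) \<and> fdeg_le S n (left_diff S s f))"

definition poly_maps :: "nat \<Rightarrow> ('s, 'm) monoid_scheme \<Rightarrow> ('s \<Rightarrow> 'g::ab_group_add) set" where
  "poly_maps n S = {f. fdeg_le S n f}"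

definition free_monoid :: "'a set \<Rightarrow> 'a list monoid" where
  "free_monoid A = \<lparr>carrier = lists A, mult = (@), one = []\<rparr>"

text \<open>The lists \<open>is\<close> are the increasing tuples of (zero-based) positions in \<open>x\<close>
  at which \<open>w\<close> is read off.\<close>

definition subword_count :: "'a list \<Rightarrow> 'a list \<Rightarrow> nat" where
  "subword_count w x =
     card {is. sorted_wrt (<) is \<and> set is \<subseteq> {..<length x} \<and> map ((!) x) is = w}"

definition subword_combinations :: "nat \<Rightarrow> 'a set \<Rightarrow> ('a list \<Rightarrow> complex) set" where
  "subword_combinations n B =
     {g. \<exists>W c. finite W \<and> W \<subseteq> {w \<in> lists B. length w \<le> n} \<and>
           (\<forall>x\<in>lists B. g x = (\<Sum>w\<in>W. c w * of_nat (subword_count w x)))}"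

lemma fdeg_le_cong:
  assumes "monoid S" and "\<And>x. x \<in> carrier S \<Longrightarrow> f x = g x"
  shows "fdeg_le S n f \<longleftrightarrow> fdeg_le S n g"
  using assms(2)
proof (induction n arbitrary: f g)
  case 0
  then show ?case by simp
next
  case (Suc n)
  have "fdeg_le S n (right_diff S s f) \<longleftrightarrow> fdeg_le S n (right_diff S s g)"
    and "fdeg_le S n (left_diff S s f) \<longleftrightarrow> fdeg_le S n (left_diff S s g)"
    if "s \<in> carrier S" for s
    using that Suc.prems monoid.m_closed[OF assms(1)]
    by (auto intro!: Suc.IH simp: right_diff_def left_diff_def)
  then show ?case by simp
qed

lemma monoid_free_monoid: "monoid (free_monoid A)"
  by (rule monoidI) (auto simp: free_monoid_def)

end

(* Appending a letter b to x changes [x]_(wa) by [x]_w if a = b and by 0 otherwise.  Hence a map f of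
   degree <= n + 1 over a finite alphabet is recovered from the degree <= n maps R_a f, a a letter, by
   "integration": if R_a f = sum_w c_(a,w) f_w for every letter a, then
   f = f(eps) + sum_(a,w) c_(a,w) f_(wa).  Conversely, the Vandermonde-type identity
   [xy]_w = sum_(w = uv) [x]_u [y]_v shows that L_s and R_s lower the length of subword counters.
   Finite alphabets suffice because every condition defining the degree involves only finitely many
   words at a time. *)
theory Submission
  imports Defs
begin

section \<open>Subword counters\<close>

abbreviation subword_positions :: "'a list \<Rightarrow> 'a list \<Rightarrow> nat list set" where
  "subword_positions w x \<equiv>
     {is. sorted_wrt (<) is \<and> set is \<subseteq> {..<length x} \<and> map ((!) x) is = w}"

lemma subword_count_Nil [simp]: "subword_count [] x = 1"
proof -
  have "subword_positions [] x = {[]}" by auto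
  then show ?thesis by (simp add: subword_count_def)
qed

lemma subword_count_Nil2 [simp]: "w \<noteq> [] \<Longrightarrow> subword_count w [] = 0"
  by (auto simp: subword_count_def)

lemma finite_subword_positions: "finite (subword_positions w x)"
proof (rule finite_subset)
  show "subword_positions w x \<subseteq> {is. set is \<subseteq> {..<length x} \<and> length is = length w}" by auto
  show "finite {is. set is \<subseteq> {..<length x} \<and> length is = length w}"
    by (rule finite_lists_length_eq) simp
qed

lemma map_nth_append_left:
  "set is \<subseteq> {..<length x} \<Longrightarrow> map ((!) (x @ y)) is = map ((!) x) is"
  by (auto simp: nth_append)

text \<open>An occurrence of \<open>w @ [b]\<close> in \<open>x @ [a]\<close> either lies within
  \<open>x\<close> or has the new position \<open>length x\<close> as its last entry. The latter
  forces \<open>a = b\<close>, and removing that entry leaves an occurrence of \<open>w\<close> in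
  \<open>x\<close>.\<close>

lemma subword_positions_snoc:
  "subword_positions (w @ [b]) (x @ [a]) =
     subword_positions (w @ [b]) x \<union>
     (if a = b then (\<lambda>is. is @ [length x]) ` subword_positions w x else {})"
  (is "?L = ?R")
proof
  show "?L \<subseteq> ?R"
  proof
    fix "is" assume L: "is \<in> ?L"
    then have "is \<noteq> []" by auto
    then obtain js j where js: "is = js @ [j]" by (metis rev_exhaust)
    from L have sorted: "sorted_wrt (<) js" "\<forall>i\<in>set js. i < j" and j: "j < Suc (length x)"
      and w: "map ((!) (x @ [a])) js = w" "(x @ [a]) ! j = b"
      by (auto simp: js sorted_wrt_append)
    \<comment> \<open>Entries before \<open>j\<close> are strictly smaller than
      \<open>j \<le> length x\<close>, so they are positions of \<open>x\<close> in both cases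
      below.\<close>
    have sub: "set js \<subseteq> {..<length x}" using sorted j by fastforce
    have wx: "map ((!) x) js = w" using w(1) map_nth_append_left[OF sub] by metis
    show "is \<in> ?R"
    proof (cases "j = length x")
      case True
      then show ?thesis using sorted sub wx w(2) by (auto simp: js)
    next
      case False
      then have "j < length x" using j by simp
      then show ?thesis using sorted sub wx w(2) by (auto simp: js sorted_wrt_append nth_append)
    qed
  qed
  have "is \<in> ?L" if "is \<in> subword_positions (w @ [b]) x" for "is"
  proof -
    from that have "map ((!) (x @ [a])) is = w @ [b]"
      using map_nth_append_left[of "is" x "[a]"] by simp
    with that show ?thesis by (auto simp: less_Suc_eq)
  qed
  moreover have "is @ [length x] \<in> ?L" if "is \<in> subword_positions w x" "a = b" for "is"
  proof -
    from that have "map ((!) (x @ [a])) is = w"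
      using map_nth_append_left[of "is" x "[a]"] by simp
    with that show ?thesis by (auto simp: sorted_wrt_append less_Suc_eq)
  qed
  ultimately show "?R \<subseteq> ?L" by (auto split: if_splits)
qed

lemma subword_count_snoc:
  "subword_count (w @ [b]) (x @ [a]) =
     subword_count (w @ [b]) x + (if a = b then subword_count w x else 0)"
proof (cases "a = b")
  case True
  \<comment> \<open>Tuples of the second kind contain \<open>length x\<close>, which is not a
    position of \<open>x\<close>.\<close>
  have "subword_positions (w @ [b]) x \<inter> (\<lambda>is. is @ [length x]) ` subword_positions w x = {}"
    by auto
  moreover have "inj_on (\<lambda>is. is @ [length x]) (subword_positions w x)"
    by (simp add: inj_on_def)
  ultimately show ?thesis
    unfolding subword_count_def subword_positions_snoc using True
    by (simp add: card_Un_disjoint card_image finite_subword_positions)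
next
  case False
  then show ?thesis unfolding subword_count_def subword_positions_snoc by simp
qed

text \<open>An occurrence of \<open>w\<close> splits at the border between \<open>x\<close> and
  \<open>y\<close> into a prefix of \<open>w\<close> read in \<open>x\<close> and a suffix read in
  \<open>y\<close>. Induction on \<open>y\<close> from the right reduces this to the recurrence for
  appending one letter.\<close>

lemma subword_count_append:
  "subword_count w (x @ y) =
     (\<Sum>i\<le>length w. subword_count (take i w) x * subword_count (drop i w) y)"
proof (induction y arbitrary: w rule: rev_induct)
  case Nil
  have "subword_count (drop i w) [] = 0" if "i < length w" for i
    using that by simp
  then have "(\<Sum>i\<le>length w. subword_count (take i w) x * subword_count (drop i w) []) =
      (\<Sum>i\<in>{length w}. subword_count (take i w) x * subword_count (drop i w) [])"
    by (intro sum.mono_neutral_right) auto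
  then show ?case by simp
next
  case (snoc a y)
  show ?case
  proof (cases w rule: rev_cases)
    case Nil
    then show ?thesis by simp
  next
    case [simp]: (snoc v b)
    \<comment> \<open>The summand \<open>i = length w\<close> is split off, since its empty suffix
      does not end in \<open>b\<close>; every other suffix has the form
      \<open>drop i v @ [b]\<close>.\<close>
    have "(\<Sum>i\<le>length w. subword_count (take i w) x * subword_count (drop i w) (y @ [a])) =
        (\<Sum>i\<le>length v. subword_count (take i v) x * subword_count (drop i v @ [b]) (y @ [a]))
          + subword_count w x"
      by simp
    also have "\<dots> =
        (\<Sum>i\<le>length v. subword_count (take i v) x * subword_count (drop i v @ [b]) y)
          + subword_count w x + (if a = b then subword_count v (x @ y) else 0)"
      by (simp add: subword_count_snoc snoc.IH distrib_left sum.distrib)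
    also have "\<dots> = subword_count w (x @ y) + (if a = b then subword_count v (x @ y) else 0)"
      unfolding snoc.IH[of w] by simp
    also have "\<dots> = subword_count w (x @ y @ [a])"
      using subword_count_snoc[of v b "x @ y" a] by simp
    finally show ?thesis by simp
  qed
qed

section \<open>Linear combinations of subword counters\<close>

lemma subword_combinations_cong:
  assumes "\<And>x. x \<in> lists B \<Longrightarrow> f x = g x"
  shows "f \<in> subword_combinations n B \<longleftrightarrow> g \<in> subword_combinations n B"
  using assms by (simp add: subword_combinations_def)

lemma subword_combinations_monomial:
  assumes "w \<in> lists B" "length w \<le> n"
  shows "(\<lambda>x. c * of_nat (subword_count w x)) \<in> subword_combinations n B"
  unfolding subword_combinations_def using assms
  by (auto intro!: exI[of _ "{w}"] exI[of _ "\<lambda>_. c"])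

lemma subword_combinations_const: "(\<lambda>x. c) \<in> subword_combinations n B"
  using subword_combinations_monomial[of "[]" B n c] by simp

lemma subword_combinations_add:
  assumes "g \<in> subword_combinations n B" "h \<in> subword_combinations n B"
  shows "(\<lambda>x. g x + h x) \<in> subword_combinations n B"
proof -
  obtain V c where V: "finite V" "V \<subseteq> {w \<in> lists B. length w \<le> n}"
    and g: "\<forall>x\<in>lists B. g x = (\<Sum>w\<in>V. c w * of_nat (subword_count w x))"
    using assms(1) unfolding subword_combinations_def by blast
  obtain W d where W: "finite W" "W \<subseteq> {w \<in> lists B. length w \<le> n}"
    and h: "\<forall>x\<in>lists B. h x = (\<Sum>w\<in>W. d w * of_nat (subword_count w x))"
    using assms(2) unfolding subword_combinations_def by blast
  \<comment> \<open>\<open>V\<close> and \<open>W\<close> may overlap, so both coefficient families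
    are extended by zero to the union before they are added.\<close>
  define e where "e w = (if w \<in> V then c w else 0) + (if w \<in> W then d w else 0)" for w
  have "g x + h x = (\<Sum>w\<in>V \<union> W. e w * of_nat (subword_count w x))" if "x \<in> lists B" for x
  proof -
    have "g x = (\<Sum>w\<in>V \<union> W. (if w \<in> V then c w else 0) * of_nat (subword_count w x))"
      using that g V W by (auto intro!: sum.mono_neutral_cong_left)
    moreover have "h x = (\<Sum>w\<in>V \<union> W. (if w \<in> W then d w else 0) * of_nat (subword_count w x))"
      using that h V W by (auto intro!: sum.mono_neutral_cong_left)
    ultimately show ?thesis by (simp add: e_def distrib_right sum.distrib)
  qed
  moreover have "finite (V \<union> W)" "V \<union> W \<subseteq> {w \<in> lists B. length w \<le> n}" using V W by auto
  ultimately show ?thesis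
    unfolding subword_combinations_def mem_Collect_eq by blast
qed

lemma subword_combinations_sum:
  assumes "\<And>i. i \<in> I \<Longrightarrow> g i \<in> subword_combinations n B"
  shows "(\<lambda>x. \<Sum>i\<in>I. g i x) \<in> subword_combinations n B"
  using assms
proof (induction I rule: infinite_finite_induct)
  case (insert i I)
  then show ?case using subword_combinations_add[of "g i" n B] by simp
\<comment> \<open>A sum over an infinite set is 0 by convention, as is the empty sum.\<close>
qed (simp_all add: subword_combinations_const)

text \<open>In the expansion of \<open>subword_count w (x @ s)\<close> the summand
  \<open>i = length w\<close> is \<open>subword_count w x\<close> and cancels. The remaining
  prefixes \<open>take i w\<close> are shorter than \<open>w\<close>, and the counts in
  \<open>s\<close> become coefficients.\<close>

lemma right_diff_subword_combinations:
  assumes g: "g \<in> subword_combinations (Suc n) B" and s: "s \<in> lists B"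
  shows "right_diff (free_monoid B) s g \<in> subword_combinations n B"
proof -
  obtain W c where W: "finite W" "W \<subseteq> {w \<in> lists B. length w \<le> Suc n}"
    and gx: "\<forall>x\<in>lists B. g x = (\<Sum>w\<in>W. c w * of_nat (subword_count w x))"
    using g unfolding subword_combinations_def by blast
  have "right_diff (free_monoid B) s g x = (\<Sum>w\<in>W. \<Sum>i<length w.
      c w * of_nat (subword_count (drop i w) s) * of_nat (subword_count (take i w) x))"
    if "x \<in> lists B" for x
    using that s gx
    by (simp add: right_diff_def free_monoid_def subword_count_append
        lessThan_Suc_atMost[symmetric] sum_subtractf[symmetric] algebra_simps sum_distrib_left)
  moreover have "(\<lambda>x. \<Sum>w\<in>W. \<Sum>i<length w.
      c w * of_nat (subword_count (drop i w) s) * of_nat (subword_count (take i w) x))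
    \<in> subword_combinations n B"
    using W by (intro subword_combinations_sum subword_combinations_monomial)
      (auto dest: in_set_takeD)
  ultimately show ?thesis by (rule subword_combinations_cong[THEN iffD2])
qed

text \<open>Mirror image of the right difference: in the expansion over \<open>s @ x\<close> the
  summand \<open>i = 0\<close> cancels. The shift to \<open>Suc i\<close> runs over the remaining,
  strictly shorter suffixes.\<close>

lemma left_diff_subword_combinations:
  assumes g: "g \<in> subword_combinations (Suc n) B" and s: "s \<in> lists B"
  shows "left_diff (free_monoid B) s g \<in> subword_combinations n B"
proof -
  obtain W c where W: "finite W" "W \<subseteq> {w \<in> lists B. length w \<le> Suc n}"
    and gx: "\<forall>x\<in>lists B. g x = (\<Sum>w\<in>W. c w * of_nat (subword_count w x))"
    using g unfolding subword_combinations_def by blast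
  have "left_diff (free_monoid B) s g x = (\<Sum>w\<in>W. \<Sum>i<length w.
      c w * of_nat (subword_count (take (Suc i) w) s) * of_nat (subword_count (drop (Suc i) w) x))"
    if "x \<in> lists B" for x
    using that s gx
    by (simp add: left_diff_def free_monoid_def subword_count_append sum.atMost_shift
        sum_subtractf[symmetric] algebra_simps sum_distrib_left)
  moreover have "(\<lambda>x. \<Sum>w\<in>W. \<Sum>i<length w.
      c w * of_nat (subword_count (take (Suc i) w) s) * of_nat (subword_count (drop (Suc i) w) x))
    \<in> subword_combinations n B"
    using W by (intro subword_combinations_sum subword_combinations_monomial)
      (auto dest: in_set_dropD)
  ultimately show ?thesis by (rule subword_combinations_cong[THEN iffD2])
qed

text \<open>A function on words over \<open>B\<close> is determined by its value at
  \<open>[]\<close> and its right differences along single letters, so it suffices to find a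
  combination with the same data.\<close>

lemma subword_combinations_integrate:
  assumes fin: "finite B"
    and diff: "\<And>a. a \<in> B \<Longrightarrow> right_diff (free_monoid B) [a] f \<in> subword_combinations n B"
  shows "f \<in> subword_combinations (Suc n) B"
proof -
  have "\<forall>a\<in>B. \<exists>W c. W \<subseteq> {w \<in> lists B. length w \<le> n} \<and>
      (\<forall>x\<in>lists B. f (x @ [a]) - f x = (\<Sum>w\<in>W. c w * of_nat (subword_count w x)))"
    using diff unfolding subword_combinations_def right_diff_def free_monoid_def monoid.simps
      mem_Collect_eq by meson
  then obtain W c where Wc: "\<forall>a\<in>B. W a \<subseteq> {w \<in> lists B. length w \<le> n} \<and>
      (\<forall>x\<in>lists B. f (x @ [a]) - f x = (\<Sum>w\<in>W a. c a w * of_nat (subword_count w x)))"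
    unfolding bchoice_iff by blast
  then have W: "W a \<subseteq> {w \<in> lists B. length w \<le> n}" if "a \<in> B" for a
    using that by blast
  have f: "f (x @ [a]) = f x + (\<Sum>w\<in>W a. c a w * of_nat (subword_count w x))"
    if "a \<in> B" "x \<in> lists B" for a x
    using Wc that by (metis add.commute diff_add_cancel)
  \<comment> \<open>A discrete antiderivative: \<open>w @ [a]\<close> is counted by a function whose
    right difference along \<open>b\<close> is the counter of \<open>w\<close> if
    \<open>a = b\<close> and 0 otherwise.\<close>
  define g where
    "g x = f [] + (\<Sum>a\<in>B. \<Sum>w\<in>W a. c a w * of_nat (subword_count (w @ [a]) x))" for x
  have g_snoc: "g (x @ [b]) = g x + (\<Sum>w\<in>W b. c b w * of_nat (subword_count w x))" if "b \<in> B" for x b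
  proof -
    have "g (x @ [b]) = g x +
        (\<Sum>a\<in>B. \<Sum>w\<in>W a. if b = a then c a w * of_nat (subword_count w x) else 0)"
      by (simp add: g_def subword_count_snoc sum.distrib[symmetric] if_distrib algebra_simps
          cong: if_cong)
    also have "(\<Sum>a\<in>B. \<Sum>w\<in>W a. if b = a then c a w * of_nat (subword_count w x) else 0) =
        (\<Sum>a\<in>B. if b = a then \<Sum>w\<in>W a. c a w * of_nat (subword_count w x) else 0)"
      by (intro sum.cong) auto
    finally show ?thesis using fin that by simp
  qed
  have "f x = g x" if "x \<in> lists B" for x
    using that
  proof (induction x rule: rev_induct)
    case Nil
    show ?case by (simp add: g_def)
  next
    case (snoc b x)
    then show ?case by (simp add: f g_snoc)
  qed
  moreover have "g \<in> subword_combinations (Suc n) B"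
    unfolding g_def using W
    by (intro subword_combinations_add subword_combinations_const subword_combinations_sum
        subword_combinations_monomial) auto
  ultimately show ?thesis by (rule subword_combinations_cong[THEN iffD2])
qed

section \<open>Polynomial maps on free monoids\<close>

lemma carrier_free_monoid [simp]: "carrier (free_monoid A) = lists A"
  by (simp add: free_monoid_def)

text \<open>Writing the differences with \<open>@\<close> removes the alphabet from them, so the
  same difference functions can be compared over different alphabets.\<close>

lemma fdeg_le_Suc_free_monoid:
  "fdeg_le (free_monoid A) (Suc n) f \<longleftrightarrow>
     (\<forall>s\<in>lists A. fdeg_le (free_monoid A) n (\<lambda>t. f (t @ s) - f t) \<and>
                  fdeg_le (free_monoid A) n (\<lambda>t. f (s @ t) - f t))"
  by (simp add: right_diff_def left_diff_def free_monoid_def)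

lemma fdeg_le_free_monoid_mono:
  assumes "B \<subseteq> A" "fdeg_le (free_monoid A) n f"
  shows "fdeg_le (free_monoid B) n f"
  using assms(2)
proof (induction n arbitrary: f)
  case 0
  then obtain c where "\<forall>x\<in>lists A. f x = c" by auto
  then have "\<forall>x\<in>lists B. f x = c" using lists_mono[OF assms(1)] by blast
  then show ?case by auto
next
  case (Suc n)
  from Suc.prems show ?case
    unfolding fdeg_le_Suc_free_monoid using Suc.IH lists_mono[OF assms(1)] by blast
qed

text \<open>For the direction from finite alphabets to \<open>A\<close>, the induction hypothesis is
  applied to the differences of \<open>f\<close>, whose degree must be bounded over every finite
  \<open>B\<close>.\<close>

lemma fdeg_le_free_monoid_finite_alphabets:
  "fdeg_le (free_monoid A) n f \<longleftrightarrow>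
     (\<forall>B. finite B \<and> B \<subseteq> A \<longrightarrow> fdeg_le (free_monoid B) n f)"
proof (intro iffI allI impI)
  assume "\<forall>B. finite B \<and> B \<subseteq> A \<longrightarrow> fdeg_le (free_monoid B) n f"
  then show "fdeg_le (free_monoid A) n f"
  proof (induction n arbitrary: f)
    case 0
    \<comment> \<open>The constant may depend on the alphabet, but \<open>[]\<close> is a word over
      all of them and pins it to \<open>f []\<close>.\<close>
    have "f x = f []" if "x \<in> lists A" for x
    proof -
      have "fdeg_le (free_monoid (set x)) 0 f" using 0 that by (auto simp: in_lists_conv_set)
      then obtain c where "\<forall>y\<in>lists (set x). f y = c" by auto
      then show ?thesis by (metis in_lists_conv_set lists.Nil)
    qed
    then show ?case unfolding fdeg_le.simps carrier_free_monoid by blast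
  next
    case (Suc n)
    have "fdeg_le (free_monoid B) n (\<lambda>t. f (t @ s) - f t)
        \<and> fdeg_le (free_monoid B) n (\<lambda>t. f (s @ t) - f t)"
      if "s \<in> lists A" "finite B" "B \<subseteq> A" for s B
    proof -
      \<comment> \<open>Adjoining the letters of \<open>s\<close> keeps the alphabet finite and
        makes \<open>s\<close> an admissible shift; afterwards the bound is restricted to
        \<open>B\<close>.\<close>
      let ?C = "B \<union> set s"
      have "finite ?C" "?C \<subseteq> A" using that by auto
      then have "fdeg_le (free_monoid ?C) (Suc n) f" using Suc.prems by blast
      moreover have "s \<in> lists ?C" by auto
      ultimately have "fdeg_le (free_monoid ?C) n (\<lambda>t. f (t @ s) - f t)
          \<and> fdeg_le (free_monoid ?C) n (\<lambda>t. f (s @ t) - f t)"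
        unfolding fdeg_le_Suc_free_monoid by blast
      then show ?thesis using fdeg_le_free_monoid_mono[of B ?C] by blast
    qed
    then show ?case
      unfolding fdeg_le_Suc_free_monoid by (intro ballI conjI Suc.IH allI impI) blast+
  qed
qed (use fdeg_le_free_monoid_mono in blast)

text \<open>In the induction step, polynomial maps become combinations by integrating the right
  differences along one-letter words; the converse is that both differences of a combination lower
  the length bound.\<close>

lemma fdeg_le_iff_subword_combinations:
  assumes "finite B"
  shows "fdeg_le (free_monoid B) n f \<longleftrightarrow> f \<in> subword_combinations n B"
proof (induction n arbitrary: f)
  case 0
  show ?case
  proof
    assume "fdeg_le (free_monoid B) 0 f"
    then obtain c where "\<forall>x\<in>lists B. f x = c" by auto
    then show "f \<in> subword_combinations 0 B"
      using subword_combinations_cong[of B f "\<lambda>_. c" 0] subword_combinations_const by blast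
  next
    assume "f \<in> subword_combinations 0 B"
    then obtain W c where "W \<subseteq> {w \<in> lists B. length w \<le> 0}"
      and f: "\<forall>x\<in>lists B. f x = (\<Sum>w\<in>W. c w * of_nat (subword_count w x))"
      unfolding subword_combinations_def by blast
    \<comment> \<open>Only \<open>[]\<close> can belong to \<open>W\<close>, and its counter is 1
      everywhere.\<close>
    then have "f x = (\<Sum>w\<in>W. c w)" if "x \<in> lists B" for x
      using that by (auto intro!: sum.cong)
    then show "fdeg_le (free_monoid B) 0 f" by auto
  qed
next
  case (Suc n)
  show ?case
    using Suc subword_combinations_integrate[OF assms, of f n]
      right_diff_subword_combinations[of f n B] left_diff_subword_combinations[of f n B]
    by auto
qed

theorem theorem3p2:
  fixes A :: "'a set" and f :: "'a list \<Rightarrow> complex" and n :: nat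
  shows "(f \<in> poly_maps n (free_monoid A) \<longleftrightarrow>
            (\<forall>B. finite B \<and> B \<subseteq> A \<longrightarrow> restrict f (lists B) \<in> subword_combinations n B))
       \<and> (f \<in> poly_maps n (free_monoid A) \<longleftrightarrow>
            (\<forall>B. finite B \<and> B \<subseteq> A \<longrightarrow> restrict f (lists B) \<in> poly_maps n (free_monoid B)))"
proof -
  \<comment> \<open>\<open>restrict\<close> yields \<open>undefined\<close> outside
    \<open>lists B\<close>, but the degree depends only on values on the carrier.\<close>
  have "fdeg_le (free_monoid B) n (restrict f (lists B)) \<longleftrightarrow> fdeg_le (free_monoid B) n f" for B
    by (rule fdeg_le_cong[OF monoid_free_monoid]) simp
  then show ?thesis
    using fdeg_le_free_monoid_finite_alphabets[of A n f]
    by (auto simp: poly_maps_def fdeg_le_iff_subword_combinations[symmetric])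
qed

end
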